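(* Let $\mathcal K = (S, A, R, I, AP, \ell)$ be a labeled Kripke structure and let $\lambda$ be an intensional strategy on $\mathcal K$. Then: (i) if $E(\lambda)$ is $\omega$-regular (over the alphabet $S \cup A$), there exists a finite Kripke structure $\mathcal K'$ that is bisimilar to the unwinding $\mathcal U(\mathcal K, \lambda)$; (ii) the converse of (i) does not hold: there exist $\mathcal K$ and $\lambda$ such that some finite Kripke structure is bisimilar to $\mathcal U(\mathcal K,\lambda)$ but $E(\lambda)$ is not $\omega$-regular; (iii) if there exists a finite Kripke structure $\mathcal K'$ bisimilar to $\mathcal U(\mathcal K, \lambda)$, then $\ell(E(\lambda))$ is $\omega$-regular (over the alphabet $\mathcal P(AP) \cup A$).
   Context: A labeled Kripke structure is $\mathcal K = (S, A, R, I, AP, \ell)$ with states $S$, actions $A$, transition relation $R \subseteq S \times A \times S$ (write $s \to^a s'$ for $(s,a,s') \in R$), initial states $I \subseteq S$, atomic propositions $AP$ and labeling $\ell : S \to \mathcal P(AP)$. Executions are written as words $s_0 a_1 s_1 a_2 s_2 \cdots$ alternating states and actions with $s_k \to^{a_{k+1}} s_{k+1}$. An intensional strategy is a partial function $\lambda : (S \cup A)^+ \to \mathcal P(A \times S)$ such that $(a, s') \in \lambda(ws)$ implies $s \to^a s'$. Following the standing convention that only infinite (nonterminating) executions are considered, $E(\lambda) = \{ s_0 a_1 s_1 a_2 s_2 \cdots \in (S\cup A)^\omega : (a_{k+1}, s_{k+1}) \in \lambda(s_0 a_1 s_1 \cdots a_k s_k) \text{ for all } k \}$. For a word $w$, $\ell(w)$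 replaces each state $s$ by $\ell(s)$ and leaves actions unchanged; $\ell(E(\lambda)) = \{\ell(w) : w \in E(\lambda)\}$. The unwinding $\mathcal U(\mathcal K,\lambda)$ is the Kripke structure $((S \cup A)^+, A, U, I, AP, \ell \circ \mathrm{last})$ where $(w, a, was) \in U$ iff $(a, s) \in \lambda(w)$, and $\mathrm{last}(ws) = s$. Given two Kripke structures $\mathcal K_1 = (S_1, A, R_1, I_1, AP, \ell_1)$, $\mathcal K_2 = (S_2, A, R_2, I_2, AP, \ell_2)$, a bisimulation is a relation $B \subseteq S_1 \times S_2$ such that whenever $(s_1, s_2) \in B$: $\ell_1(s_1) = \ell_2(s_2)$; for every $(s_1, a, s_1') \in R_1$ there is $s_2'$ with $(s_2, a, s_2') \in R_2$ and $(s_1', s_2') \in B$; and symmetrically. $\mathcal K_1$ and $\mathcal K_2$ are bisimilar if every initial state of each is related by some bisimulation to an initial state of the other.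
   Formalization: Two conventions are made explicit because the claim fails without them: words of E(λ) start in an initial state (needed for (iii)), and in (i) every finite execution from I following λ can be continued; ω-regular and finite Kripke structure include finitely many transitions. *)

theory Defs
  imports Main
begin

section \<open>Labeled Kripke structures\<close>

record ('s, 'a, 'p) kripke =
  states  :: "'s set"
  actions :: "'a set"
  steps   :: "('s \<times> 'a \<times> 's) set"
  inits   :: "'s set"
  props   :: "'p set"
  label   :: "'s \<Rightarrow> 'p set"

definition kripke_structure :: "('s, 'a, 'p) kripke \<Rightarrow> bool" where
  "kripke_structure K \<longleftrightarrow>
     steps K \<subseteq> states K \<times> actions K \<times> states K \<and>
     inits K \<subseteq> states K \<and>
     (\<forall>s \<in> states K. label K s \<subseteq> props K)"

text \<open>For a finite set of actions, finiteness of the transition relation follows from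
  finiteness of the set of states.\<close>

definition finite_kripke :: "('s, 'a, 'p) kripke \<Rightarrow> bool" where
  "finite_kripke K \<longleftrightarrow> kripke_structure K \<and> finite (states K) \<and> finite (steps K)"

section \<open>Intensional strategies and their executions\<close>

text \<open>Words over \<open>S \<union> A\<close> have letters in the sum type, so that states and actions are disjoint.\<close>

definition letters :: "('s, 'a, 'p) kripke \<Rightarrow> ('s + 'a) set" where
  "letters K = Inl ` states K \<union> Inr ` actions K"

definition words :: "('s, 'a, 'p) kripke \<Rightarrow> ('s + 'a) list set" where
  "words K = {w. w \<noteq> [] \<and> set w \<subseteq> letters K}"

type_synonym ('s, 'a) strategy = "('s + 'a) list \<rightharpoonup> ('a \<times> 's) set"

text \<open>Where the strategy is undefined, no continuation is allowed.\<close>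

definition choices :: "('s, 'a) strategy \<Rightarrow> ('s + 'a) list \<Rightarrow> ('a \<times> 's) set" where
  "choices lam w = (case lam w of None \<Rightarrow> {} | Some X \<Rightarrow> X)"

definition intensional_strategy :: "('s, 'a, 'p) kripke \<Rightarrow> ('s, 'a) strategy \<Rightarrow> bool" where
  "intensional_strategy K lam \<longleftrightarrow>
     dom lam \<subseteq> words K \<and>
     (\<forall>w. choices lam w \<subseteq> actions K \<times> states K) \<and>
     (\<forall>w s a s'. (a, s') \<in> choices lam (w @ [Inl s]) \<longrightarrow> (s, a, s') \<in> steps K)"

text \<open>The word \<open>s\<^sub>0 a\<^sub>1 s\<^sub>1 a\<^sub>2 \<dots>\<close> has \<open>s\<^sub>k\<close> at position \<open>2 * k\<close> and \<open>a\<^sub>k\<^sub>+\<^sub>1\<close> at position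
  \<open>2 * k + 1\<close>, so \<open>map w [0..<2 * k + 1]\<close> is the prefix ending in \<open>s\<^sub>k\<close>. Executions start in an
  initial state.\<close>

definition executions :: "('s, 'a, 'p) kripke \<Rightarrow> ('s, 'a) strategy \<Rightarrow> (nat \<Rightarrow> 's + 'a) set" where
  "executions K lam =
     {w. \<exists>s a. s 0 \<in> inits K \<and>
        (\<forall>k. w (2 * k) = Inl (s k) \<and> w (2 * k + 1) = Inr (a (k + 1)) \<and>
             (a (k + 1), s (k + 1)) \<in> choices lam (map w [0..<2 * k + 1]))}"

inductive_set finite_executions ::
    "('s, 'a, 'p) kripke \<Rightarrow> ('s, 'a) strategy \<Rightarrow> ('s + 'a) list set"
  for K :: "('s, 'a, 'p) kripke" and lam :: "('s, 'a) strategy" where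
  start: "s \<in> inits K \<Longrightarrow> [Inl s] \<in> finite_executions K lam"
| extend: "w \<in> finite_executions K lam \<Longrightarrow> (a, s) \<in> choices lam w \<Longrightarrow>
     w @ [Inr a, Inl s] \<in> finite_executions K lam"

text \<open>The convention that executions do not terminate. Without it, branches of the unwinding that
  end in a deadlock would leave no trace in the set of infinite executions.\<close>

definition nonterminating :: "('s, 'a, 'p) kripke \<Rightarrow> ('s, 'a) strategy \<Rightarrow> bool" where
  "nonterminating K lam \<longleftrightarrow> (\<forall>w \<in> finite_executions K lam. choices lam w \<noteq> {})"

definition label_word :: "('s, 'a, 'p) kripke \<Rightarrow> (nat \<Rightarrow> 's + 'a) \<Rightarrow> (nat \<Rightarrow> 'p set + 'a)" where
  "label_word K w = map_sum (label K) id \<circ> w"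

definition label_letters :: "('s, 'a, 'p) kripke \<Rightarrow> ('p set + 'a) set" where
  "label_letters K = Inl ` Pow (props K) \<union> Inr ` actions K"

section \<open>Unwinding\<close>

text \<open>\<open>last\<close> is only meaningful on words ending in a state; the other words are not reachable in
  the unwinding and get the empty label.\<close>

definition unwinding ::
    "('s, 'a, 'p) kripke \<Rightarrow> ('s, 'a) strategy \<Rightarrow> (('s + 'a) list, 'a, 'p) kripke" where
  "unwinding K lam =
     \<lparr> states = words K,
       actions = actions K,
       steps = {(w, a, w @ [Inr a, Inl s]) | w a s. w \<in> words K \<and> (a, s) \<in> choices lam w},
       inits = (\<lambda>s. [Inl s]) ` inits K,
       props = props K,
       label = (\<lambda>w. case last w of Inl s \<Rightarrow> label K s | Inr _ \<Rightarrow> {}) \<rparr>"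

lemma kripke_structure_unwinding:
  assumes "kripke_structure K" and "intensional_strategy K lam"
  shows "kripke_structure (unwinding K lam)"
proof -
  have "label (unwinding K lam) w \<subseteq> props K" if "w \<in> words K" for w
  proof -
    have "last w \<in> letters K"
      using that last_in_set[of w] by (auto simp: words_def)
    then show ?thesis
      using assms(1) by (auto simp: unwinding_def letters_def kripke_structure_def) blast
  qed
  moreover have "w @ [Inr a, Inl s] \<in> words K" "a \<in> actions K"
    if "w \<in> words K" "(a, s) \<in> choices lam w" for w a s
  proof -
    have "(a, s) \<in> actions K \<times> states K"
      using that assms(2) unfolding intensional_strategy_def by blast
    then show "w @ [Inr a, Inl s] \<in> words K" "a \<in> actions K"
      using that by (auto simp: words_def letters_def)
  qed
  moreover have "[Inl s] \<in> words K" if "s \<in> inits K" for s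
    using that assms(1) by (auto simp: words_def letters_def kripke_structure_def)
  ultimately show ?thesis
    unfolding kripke_structure_def by (auto simp: unwinding_def)
qed

section \<open>Bisimilarity\<close>

definition bisimulation ::
    "('s, 'a, 'p) kripke \<Rightarrow> ('t, 'a, 'p) kripke \<Rightarrow> ('s \<times> 't) set \<Rightarrow> bool" where
  "bisimulation K1 K2 B \<longleftrightarrow>
     B \<subseteq> states K1 \<times> states K2 \<and>
     (\<forall>(s1, s2) \<in> B.
        label K1 s1 = label K2 s2 \<and>
        (\<forall>a s1'. (s1, a, s1') \<in> steps K1 \<longrightarrow> (\<exists>s2'. (s2, a, s2') \<in> steps K2 \<and> (s1', s2') \<in> B)) \<and>
        (\<forall>a s2'. (s2, a, s2') \<in> steps K2 \<longrightarrow> (\<exists>s1'. (s1, a, s1') \<in> steps K1 \<and> (s1', s2') \<in> B)))"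

definition bisimilar :: "('s, 'a, 'p) kripke \<Rightarrow> ('t, 'a, 'p) kripke \<Rightarrow> bool" where
  "bisimilar K1 K2 \<longleftrightarrow>
     actions K1 = actions K2 \<and> props K1 = props K2 \<and>
     (\<forall>s1 \<in> inits K1. \<exists>s2 \<in> inits K2. \<exists>B. bisimulation K1 K2 B \<and> (s1, s2) \<in> B) \<and>
     (\<forall>s2 \<in> inits K2. \<exists>s1 \<in> inits K1. \<exists>B. bisimulation K1 K2 B \<and> (s1, s2) \<in> B)"

section \<open>Omega-regular languages\<close>

record ('q, 'x) nba =
  nba_states :: "'q set"
  nba_steps  :: "('q \<times> 'x \<times> 'q) set"
  nba_inits  :: "'q set"
  nba_final  :: "'q set"

text \<open>Finiteness of the transition relation is automatic over a finite alphabet; over an infinite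
  one, it makes the recognized languages those given by omega-regular expressions, which use only
  finitely many letters.\<close>

definition buchi_automaton :: "'x set \<Rightarrow> ('q, 'x) nba \<Rightarrow> bool" where
  "buchi_automaton \<Sigma> M \<longleftrightarrow>
     finite (nba_states M) \<and> finite (nba_steps M) \<and>
     nba_steps M \<subseteq> nba_states M \<times> \<Sigma> \<times> nba_states M \<and>
     nba_inits M \<subseteq> nba_states M \<and> nba_final M \<subseteq> nba_states M"

definition nba_language :: "('q, 'x) nba \<Rightarrow> (nat \<Rightarrow> 'x) set" where
  "nba_language M =
     {w. \<exists>r. r 0 \<in> nba_inits M \<and> (\<forall>i. (r i, w i, r (Suc i)) \<in> nba_steps M) \<and>
        infinite {i. r i \<in> nba_final M}}"

text \<open>Taking natural numbers as states is no restriction, since automata are finite.\<close>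

definition omega_regular :: "'x set \<Rightarrow> (nat \<Rightarrow> 'x) set \<Rightarrow> bool" where
  "omega_regular \<Sigma> L \<longleftrightarrow> (\<exists>M :: (nat, 'x) nba. buchi_automaton \<Sigma> M \<and> nba_language M = L)"

end

theory Submission
  imports Defs "HOL-Library.Omega_Words_Fun"
begin

text \<open>
  For (i), map a finite execution to the pair of its residual language, that is, the set of
  infinite words continuing it to an execution, and its last state. A finite automaton for the
  executions has only finitely many residual languages, and if no execution terminates, the residual
  language determines the choices of the strategy, so this map is a bisimulation onto a finite
  quotient of the unwinding.

  For (ii), take two states with equal labels, and let the strategy visit the second one exactly at
  the times that are powers of two. Identifying the two states gives a bisimilar one-state loop, but
  the single execution is not ultimately periodic.

  For (iii), bisimilar structures have the same infinite traces. The traces of a finite structure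
  are recognized by an automaton with all states final, and those of the unwinding are the labels
  of the executions.
\<close>

section \<open>Omega-regular languages\<close>

text \<open>\<open>omega_regular\<close> asks for natural numbers as states. Renaming states along
  an injection admits automata over any state type, such as the flagged states built for traces
  below.\<close>

lemma omega_regular_nba_language:
  fixes M :: "('q, 'x) nba"
  assumes "buchi_automaton \<Sigma> M"
  shows "omega_regular \<Sigma> (nba_language M)"
proof -
  have fin: "finite (nba_states M)" "finite (nba_steps M)"
    and sub: "nba_steps M \<subseteq> nba_states M \<times> \<Sigma> \<times> nba_states M"
      "nba_inits M \<subseteq> nba_states M" "nba_final M \<subseteq> nba_states M"
    using assms by (auto simp: buchi_automaton_def)
  obtain g :: "'q \<Rightarrow> nat" where g: "inj_on g (nba_states M)"
    using finite_imp_inj_to_nat_seg[OF fin(1)] by blast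
  define N where "N = \<lparr> nba_states = g ` nba_states M,
    nba_steps = (\<lambda>(p, x, q). (g p, x, g q)) ` nba_steps M,
    nba_inits = g ` nba_inits M, nba_final = g ` nba_final M \<rparr>"
  have "buchi_automaton \<Sigma> N"
    using fin sub by (auto simp: buchi_automaton_def N_def)
  moreover have "w \<in> nba_language N" if w: "w \<in> nba_language M" for w
  proof -
    obtain r where r: "r 0 \<in> nba_inits M" "\<And>i. (r i, w i, r (Suc i)) \<in> nba_steps M"
      "infinite {i. r i \<in> nba_final M}"
      using w by (auto simp: nba_language_def)
    have "infinite {i. g (r i) \<in> g ` nba_final M}"
      using r(3) by (rule contrapos_nn) (auto elim: rev_finite_subset)
    then show ?thesis
      using r(1,2) unfolding nba_language_def N_def
      by (auto intro!: exI[of _ "g \<circ> r"] rev_image_eqI)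
  qed
  moreover have "w \<in> nba_language M" if w: "w \<in> nba_language N" for w
  proof -
    obtain r where r: "r 0 \<in> nba_inits N" "\<And>i. (r i, w i, r (Suc i)) \<in> nba_steps N"
      "infinite {i. r i \<in> nba_final N}"
      using w by (auto simp: nba_language_def)
    \<comment> \<open>The inverse is meaningful only on names of states of \<open>M\<close>; a run
      of \<open>N\<close> never leaves these.\<close>
    define r' where "r' = inv_into (nba_states M) g \<circ> r"
    have inv: "inv_into (nba_states M) g (g q) = q" if "q \<in> nba_states M" for q
      using g that by simp
    have "r' 0 \<in> nba_inits M"
      using r(1) sub inv by (auto simp: N_def r'_def)
    moreover have "(r' i, w i, r' (Suc i)) \<in> nba_steps M" for i
    proof -
      obtain p q where pq: "r i = g p" "r (Suc i) = g q" "(p, w i, q) \<in> nba_steps M"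
        using r(2)[of i] by (auto simp: N_def)
      then have "p \<in> nba_states M" "q \<in> nba_states M"
        using sub by auto
      then show ?thesis
        using pq inv by (simp add: r'_def)
    qed
    moreover have "{i. r i \<in> nba_final N} \<subseteq> {i. r' i \<in> nba_final M}"
      using sub inv by (auto simp: N_def r'_def)
    then have "infinite {i. r' i \<in> nba_final M}"
      using r(3) finite_subset by blast
    ultimately show ?thesis
      by (auto simp: nba_language_def)
  qed
  ultimately show ?thesis
    unfolding omega_regular_def by blast
qed

text \<open>Each letter of an accepted word is carried by one of finitely many transitions. This
  bounds the states and actions occurring in executions even when the Kripke structure is
  infinite.\<close>

lemma omega_regular_finite_letters:
  assumes "omega_regular \<Sigma> L"
  shows "finite (\<Union>w\<in>L. range w)"
proof -
  obtain M :: "(nat, 'a) nba" where M: "finite (nba_steps M)" "nba_language M = L"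
    using assms by (auto simp: omega_regular_def buchi_automaton_def)
  have "(\<Union>w\<in>L. range w) \<subseteq> (fst \<circ> snd) ` nba_steps M"
    using M(2) by (force simp: nba_language_def)
  then show ?thesis
    using M(1) finite_surj by blast
qed

text \<open>An accepting run repeats a state. Cutting out the loop between two occurrences removes
  finitely many positions, so infinitely many visits to final states remain.\<close>

lemma omega_regular_pump:
  assumes "omega_regular \<Sigma> L" and "w \<in> L"
  obtains i d where "d > 0" and "(\<lambda>n. if n < i then w n else w (n + d)) \<in> L"
proof -
  obtain M :: "(nat, 'a) nba" where M: "buchi_automaton \<Sigma> M" "nba_language M = L"
    using assms(1) by (auto simp: omega_regular_def)
  obtain r where r: "r 0 \<in> nba_inits M" "\<And>i. (r i, w i, r (Suc i)) \<in> nba_steps M"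
    "infinite {i. r i \<in> nba_final M}"
    using assms(2) M(2) by (auto simp: nba_language_def)
  have "range r \<subseteq> nba_states M"
    using M(1) r(2) by (fastforce simp: buchi_automaton_def)
  then have "\<not> inj r"
    using M(1) finite_subset finite_imageD unfolding buchi_automaton_def by blast
  then obtain i j where "r i = r j" "i < j"
    unfolding inj_def by (metis linorder_neqE_nat)
  then obtain d where d: "d > 0" "r i = r (i + d)"
    by (metis less_imp_add_positive)
  \<comment> \<open>The seam is at \<open>n = i\<close>: the new run is in \<open>r i\<close> and
    reads \<open>w (i + d)\<close>, which is a transition because
    \<open>r i = r (i + d)\<close>.\<close>
  define r' where "r' n = (if n \<le> i then r n else r (n + d))" for n
  have "(r' n, if n < i then w n else w (n + d), r' (Suc n)) \<in> nba_steps M" for n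
    using r(2)[of n] r(2)[of "n + d"] d(2) by (cases n i rule: linorder_cases) (auto simp: r'_def)
  moreover have "infinite {n. r' n \<in> nba_final M}"
  proof
    assume "finite {n. r' n \<in> nba_final M}"
    then have "finite ({..i + d} \<union> (\<lambda>n. n + d) ` {n. r' n \<in> nba_final M})"
      by blast
    moreover have "n \<in> (\<lambda>n. n + d) ` {n. r' n \<in> nba_final M}"
      if "r n \<in> nba_final M" "\<not> n \<le> i + d" for n
      using that by (intro rev_image_eqI[of "n - d"]) (auto simp: r'_def)
    then have "{n. r n \<in> nba_final M} \<subseteq> {..i + d} \<union> (\<lambda>n. n + d) ` {n. r' n \<in> nba_final M}"
      by blast
    ultimately show False
      using r(3) finite_subset by blast
  qed
  moreover have "r' 0 \<in> nba_inits M"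
    using r(1) by (simp add: r'_def)
  ultimately have "(\<lambda>n. if n < i then w n else w (n + d)) \<in> L"
    unfolding M(2)[symmetric] nba_language_def by blast
  then show ?thesis
    using that d(1) by blast
qed

section \<open>Residual languages\<close>

definition residual :: "(nat \<Rightarrow> 'x) set \<Rightarrow> 'x list \<Rightarrow> (nat \<Rightarrow> 'x) set" where
  "residual L u = {v. u \<frown> v \<in> L}"

lemma residual_append: "residual L (u @ u') = {v. u' \<frown> v \<in> residual L u}"
  by (simp add: residual_def)

text \<open>As in the subset construction, a residual is determined by the set of states reachable
  on \<open>u\<close>: it is the union of the languages accepted from them. There are finitely many
  such sets.\<close>

lemma omega_regular_finite_residuals:
  assumes "omega_regular \<Sigma> L"
  shows "finite (range (residual L))"
proof -
  obtain M :: "(nat, 'a) nba" where M: "buchi_automaton \<Sigma> M" "nba_language M = L"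
    using assms by (auto simp: omega_regular_def)
  define acc where "acc q = nba_language (M\<lparr>nba_inits := {q}\<rparr>)" for q
  have "residual L u \<in> (\<lambda>T. \<Union>q\<in>T. acc q) ` Pow (nba_states M)" for u
  proof (rule rev_image_eqI)
    let ?T = "{q \<in> nba_states M. \<exists>r. r 0 \<in> nba_inits M \<and>
      (\<forall>i<length u. (r i, u ! i, r (Suc i)) \<in> nba_steps M) \<and> r (length u) = q}"
    show "?T \<in> Pow (nba_states M)"
      by blast
    have "v \<in> (\<Union>q\<in>?T. acc q)" if "v \<in> residual L u" for v
    proof -
      obtain r where r: "r 0 \<in> nba_inits M" "\<And>i. (r i, (u \<frown> v) i, r (Suc i)) \<in> nba_steps M"
        "infinite {i. r i \<in> nba_final M}"
        using \<open>v \<in> residual L u\<close> M(2) by (auto simp: nba_language_def residual_def)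
      have steps: "(r i, u ! i, r (Suc i)) \<in> nba_steps M" if "i < length u" for i
        using r(2)[of i] that by simp
      have "r (length u) \<in> nba_states M"
        using r(2)[of "length u"] M(1) by (auto simp: buchi_automaton_def)
      then have "r (length u) \<in> ?T"
        using r(1) steps by blast
      moreover have "(r (length u + i), v i, r (length u + Suc i)) \<in> nba_steps M" for i
        using r(2)[of "length u + i"] by simp
      moreover have "infinite {i. r (length u + i) \<in> nba_final M}"
      proof
        assume "finite {i. r (length u + i) \<in> nba_final M}"
        then have "finite ({..<length u} \<union> (+) (length u) ` {i. r (length u + i) \<in> nba_final M})"
          by blast
        moreover have "n \<in> (+) (length u) ` {i. r (length u + i) \<in> nba_final M}"
          if "r n \<in> nba_final M" "\<not> n < length u" for n
          using that by (intro rev_image_eqI[of "n - length u"]) auto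
        then have "{n. r n \<in> nba_final M} \<subseteq>
            {..<length u} \<union> (+) (length u) ` {i. r (length u + i) \<in> nba_final M}"
          by blast
        ultimately show False
          using r(3) finite_subset by blast
      qed
      ultimately have "v \<in> acc (r (length u))"
        unfolding acc_def nba_language_def by (auto intro!: exI[of _ "\<lambda>i. r (length u + i)"])
      then show ?thesis
        using \<open>r (length u) \<in> ?T\<close> by blast
    qed
    moreover have "v \<in> residual L u" if "q \<in> ?T" "v \<in> acc q" for q v
    proof -
      obtain r where r: "r 0 \<in> nba_inits M"
        "\<And>i. i < length u \<Longrightarrow> (r i, u ! i, r (Suc i)) \<in> nba_steps M" "r (length u) = q"
        using \<open>q \<in> ?T\<close> by blast
      obtain t where t: "t 0 = q" "\<And>i. (t i, v i, t (Suc i)) \<in> nba_steps M"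
        "infinite {i. t i \<in> nba_final M}"
        using \<open>v \<in> acc q\<close> by (auto simp: acc_def nba_language_def)
      \<comment> \<open>A run on \<open>u\<close> ending in \<open>q\<close> is glued to an
        accepting run on \<open>v\<close> starting in \<open>q\<close>. The two agree at position
        \<open>length u\<close>, and the finite first part does not affect acceptance.\<close>
      define r' where "r' i = (if i < length u then r i else t (i - length u))" for i
      have "r' 0 \<in> nba_inits M"
        using r(1,3) t(1) by (auto simp: r'_def)
      moreover have "(r' i, (u \<frown> v) i, r' (Suc i)) \<in> nba_steps M" for i
      proof (cases "i < length u")
        case True
        then have "r' (Suc i) = r (Suc i)"
          using r(3) t(1) by (cases "Suc i = length u") (auto simp: r'_def)
        then show ?thesis
          using True r(2) by (simp add: r'_def)
      next
        case False
        then show ?thesis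
          using t(2)[of "i - length u"] by (simp add: r'_def Suc_diff_le)
      qed
      moreover have "infinite {i. r' i \<in> nba_final M}"
      proof
        assume "finite {i. r' i \<in> nba_final M}"
        then have "finite ((\<lambda>i. i + length u) -` {i. r' i \<in> nba_final M})"
          by (rule finite_vimageI) (simp add: inj_def)
        moreover have "(\<lambda>i. i + length u) -` {i. r' i \<in> nba_final M} = {i. t i \<in> nba_final M}"
          by (auto simp: r'_def)
        ultimately show False
          using t(3) by simp
      qed
      ultimately show ?thesis
        unfolding residual_def M(2)[symmetric] nba_language_def by blast
    qed
    ultimately show "residual L u = (\<Union>q\<in>?T. acc q)"
      by blast
  qed
  moreover have "finite ((\<lambda>T. \<Union>q\<in>T. acc q) ` Pow (nba_states M))"
    using M(1) by (simp add: buchi_automaton_def)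
  ultimately show ?thesis
    by (meson finite_subset image_subsetI)
qed

section \<open>Traces and bisimulations\<close>

text \<open>Actions are counted from \<open>0\<close>: \<open>a k\<close> follows
  \<open>s k\<close>, whereas \<open>executions\<close> gives that action the number
  \<open>k + 1\<close>.\<close>

definition interleave :: "(nat \<Rightarrow> 'x) \<Rightarrow> (nat \<Rightarrow> 'y) \<Rightarrow> nat \<Rightarrow> 'x + 'y" where
  "interleave s a n = (if even n then Inl (s (n div 2)) else Inr (a (n div 2)))"

lemma interleave_double [simp]:
  "interleave s a (2 * k) = Inl (s k)" "interleave s a (Suc (2 * k)) = Inr (a k)"
  by (simp_all add: interleave_def)

lemma eq_interleaveI:
  assumes "\<And>k. w (2 * k) = Inl (s k)" and "\<And>k. w (Suc (2 * k)) = Inr (a k)"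
  shows "w = interleave s a"
proof
  fix n
  show "w n = interleave s a n"
    using assms[of "n div 2"] by (cases "even n") (auto simp: interleave_def)
qed

definition path :: "('s, 'a, 'p) kripke \<Rightarrow> (nat \<Rightarrow> 's) \<Rightarrow> (nat \<Rightarrow> 'a) \<Rightarrow> bool" where
  "path K p b \<longleftrightarrow> p 0 \<in> inits K \<and> (\<forall>k. (p k, b k, p (Suc k)) \<in> steps K)"

definition traces :: "('s, 'a, 'p) kripke \<Rightarrow> (nat \<Rightarrow> 'p set + 'a) set" where
  "traces K = {interleave (label K \<circ> p) b | p b. path K p b}"

lemma bisimulation_converse: "bisimulation K1 K2 B \<Longrightarrow> bisimulation K2 K1 (B\<inverse>)"
  unfolding bisimulation_def by fastforce

lemma bisimilar_sym: "bisimilar K1 K2 \<Longrightarrow> bisimilar K2 K1"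
  unfolding bisimilar_def by (metis bisimulation_converse converse_iff)

text \<open>One bisimulation relating the first states suffices: the path is matched step by step
  inside it, with equal labels and actions throughout.\<close>

lemma traces_subset_if_bisimilar:
  assumes "bisimilar K1 K2"
  shows "traces K1 \<subseteq> traces K2"
proof
  fix w
  assume "w \<in> traces K1"
  then obtain p b where w: "w = interleave (label K1 \<circ> p) b" and p: "path K1 p b"
    by (auto simp: traces_def)
  then obtain t B where t: "t \<in> inits K2" and B: "bisimulation K1 K2 B" and pt: "(p 0, t) \<in> B"
    using assms by (auto simp: bisimilar_def path_def)
  \<comment> \<open>The conjunct for \<open>k = 0\<close> pins the chosen sequence to the initial
    state \<open>t\<close>; otherwise it could start in a related state that is not initial.\<close>
  have "\<exists>q. \<forall>k. ((p k, q k) \<in> B \<and> (k = 0 \<longrightarrow> q k = t)) \<and> (q k, b k, q (Suc k)) \<in> steps K2"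
  proof (rule dependent_nat_choice)
    show "\<exists>x. (p 0, x) \<in> B \<and> (0 = 0 \<longrightarrow> x = t)"
      using pt by blast
    fix x k
    assume "(p k, x) \<in> B \<and> (k = 0 \<longrightarrow> x = t)"
    moreover have "(p k, b k, p (Suc k)) \<in> steps K1"
      using p by (simp add: path_def)
    ultimately show "\<exists>y. ((p (Suc k), y) \<in> B \<and> (Suc k = 0 \<longrightarrow> y = t)) \<and> (x, b k, y) \<in> steps K2"
      using B unfolding bisimulation_def by fastforce
  qed
  then obtain q where q: "\<And>k. (p k, q k) \<in> B" "q 0 = t" "\<And>k. (q k, b k, q (Suc k)) \<in> steps K2"
    by metis
  have "label K1 (p k) = label K2 (q k)" for k
    using q(1)[of k] B unfolding bisimulation_def by blast
  then have "w = interleave (label K2 \<circ> q) b"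
    by (simp add: w interleave_def fun_eq_iff)
  then show "w \<in> traces K2"
    using q t by (auto simp: traces_def path_def)
qed

lemma traces_eq_if_bisimilar: "bisimilar K1 K2 \<Longrightarrow> traces K1 = traces K2"
  by (simp add: bisimilar_sym subset_antisym traces_subset_if_bisimilar)

lemma omega_regular_traces:
  assumes "finite_kripke K"
  shows "omega_regular (label_letters K) (traces K)"
proof -
  have K: "steps K \<subseteq> states K \<times> actions K \<times> states K" "inits K \<subseteq> states K"
    "\<And>s. s \<in> states K \<Longrightarrow> label K s \<subseteq> props K" "finite (states K)" "finite (steps K)"
    using assms by (auto simp: finite_kripke_def kripke_structure_def)
  \<comment> \<open>A word reads a label and an action per step, so each state is doubled: flag
    \<open>False\<close> before its label is read, \<open>True\<close> after it. All states are
    final because every infinite path counts.\<close>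
  define M where "M = \<lparr> nba_states = states K \<times> UNIV,
    nba_steps = (\<lambda>q. ((q, False), Inl (label K q), (q, True))) ` states K \<union>
      (\<lambda>(q, a, q'). ((q, True), Inr a, (q', False))) ` steps K,
    nba_inits = inits K \<times> {False}, nba_final = states K \<times> UNIV \<rparr>"
  have "buchi_automaton (label_letters K) M"
    unfolding buchi_automaton_def using K by (auto simp: M_def label_letters_def)
  moreover have "nba_language M = traces K"
  proof (intro subset_antisym subsetI)
    fix w
    assume "w \<in> nba_language M"
    then obtain r where r: "r 0 \<in> nba_inits M" "\<And>i. (r i, w i, r (Suc i)) \<in> nba_steps M"
      by (auto simp: nba_language_def)
    have parity: "snd (r i) = odd i" for i
    proof (induction i)
      case 0
      then show ?case using r(1) by (auto simp: M_def)
    next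
      case (Suc i)
      then show ?case using r(2)[of i] by (auto simp: M_def)
    qed
    define p where "p k = fst (r (2 * k))" for k
    have even: "w (2 * k) = Inl (label K (p k)) \<and> r (Suc (2 * k)) = (p k, True)" for k
      using r(2)[of "2 * k"] parity[of "2 * k"] by (auto simp: M_def p_def)
    have "\<exists>a. w (Suc (2 * k)) = Inr a \<and> (p k, a, p (Suc k)) \<in> steps K" for k
      using r(2)[of "Suc (2 * k)"] even[of k] by (auto simp: M_def p_def)
    then obtain b where b: "\<And>k. w (Suc (2 * k)) = Inr (b k)" "\<And>k. (p k, b k, p (Suc k)) \<in> steps K"
      by metis
    have "p 0 \<in> inits K"
      using r(1) by (auto simp: M_def p_def)
    moreover have "w = interleave (label K \<circ> p) b"
      using even b(1) by (intro eq_interleaveI) auto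
    ultimately show "w \<in> traces K"
      using b(2) by (auto simp: traces_def path_def)
  next
    fix w
    assume "w \<in> traces K"
    then obtain p b where w: "w = interleave (label K \<circ> p) b" and p: "path K p b"
      by (auto simp: traces_def)
    define r where "r i = (p (i div 2), odd i)" for i
    have st: "p k \<in> states K" for k
      using p K(1) by (fastforce simp: path_def)
    have "r 0 \<in> nba_inits M"
      using p by (simp add: r_def M_def path_def)
    moreover have "(r i, w i, r (Suc i)) \<in> nba_steps M" for i
    proof (cases "even i")
      case True
      then show ?thesis
        using st by (auto simp: r_def M_def w interleave_def)
    next
      case False
      have "(p (i div 2), b (i div 2), p (Suc (i div 2))) \<in> steps K"
        using p by (simp add: path_def)
      then show ?thesis
        using False by (force simp: r_def M_def w interleave_def)
    qed
    moreover have "{i. r i \<in> nba_final M} = UNIV"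
      using st by (auto simp: r_def M_def)
    ultimately show "w \<in> nba_language M"
      unfolding nba_language_def by auto
  qed
  ultimately show ?thesis
    using omega_regular_nba_language by metis
qed

text \<open>The assumptions \<open>lab\<close> and \<open>step\<close> say that having equal values
  under \<open>h\<close> is a bisimulation on \<open>F\<close>, so merging such states preserves
  behaviour. \<open>F\<close> need only contain what is reachable, which keeps the rest of
  \<open>K\<close> out of the quotient.\<close>

lemma finite_quotient_bisimilar:
  fixes K :: "('s, 'a, 'p) kripke" and h :: "'s \<Rightarrow> 'c"
  assumes K: "kripke_structure K"
    and F: "F \<subseteq> states K" "inits K \<subseteq> F"
    and closed: "\<And>s a s'. s \<in> F \<Longrightarrow> (s, a, s') \<in> steps K \<Longrightarrow> s' \<in> F"
    and fin: "finite (h ` F)" "finite {a. \<exists>s\<in>F. \<exists>s'. (s, a, s') \<in> steps K}"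
    and lab: "\<And>s t. s \<in> F \<Longrightarrow> t \<in> F \<Longrightarrow> h s = h t \<Longrightarrow> label K s = label K t"
    and step: "\<And>s t a s'. s \<in> F \<Longrightarrow> t \<in> F \<Longrightarrow> h s = h t \<Longrightarrow> (s, a, s') \<in> steps K \<Longrightarrow>
      \<exists>t'. (t, a, t') \<in> steps K \<and> h s' = h t'"
  shows "\<exists>K' :: (nat, 'a, 'p) kripke. finite_kripke K' \<and> bisimilar K' K"
proof -
  obtain g :: "'c \<Rightarrow> nat" where g: "inj_on g (h ` F)"
    using finite_imp_inj_to_nat_seg[OF fin(1)] by blast
  define e where "e = g \<circ> h"
  have e_iff: "e s = e t \<longleftrightarrow> h s = h t" if "s \<in> F" "t \<in> F" for s t
    using g that by (auto simp: e_def inj_on_eq_iff)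
  \<comment> \<open>A class takes its label from a chosen member; \<open>lab\<close> makes the
    choice irrelevant.\<close>
  define rep where "rep = inv_into F e"
  have rep: "rep (e s) \<in> F" "h (rep (e s)) = h s" if "s \<in> F" for s
  proof -
    show "rep (e s) \<in> F"
      using that unfolding rep_def by (intro inv_into_into) simp
    moreover have "e (rep (e s)) = e s"
      using that unfolding rep_def by (intro f_inv_into_f) simp
    ultimately show "h (rep (e s)) = h s"
      using that e_iff by blast
  qed
  define K' where "K' = \<lparr> states = e ` F, actions = actions K,
    steps = {(e s, a, e s') | s a s'. s \<in> F \<and> (s, a, s') \<in> steps K},
    inits = e ` inits K, props = props K, label = (\<lambda>n. label K (rep n)) \<rparr>"
  have lab': "label K' (e s) = label K s" if "s \<in> F" for s
    using lab[OF rep(1)[OF that] that rep(2)[OF that]] by (simp add: K'_def)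
  \<comment> \<open>The actions are bounded by those occurring on \<open>F\<close>, since
    \<open>actions K\<close> may be infinite.\<close>
  have "steps K' \<subseteq> states K' \<times> {a. \<exists>s\<in>F. \<exists>s'. (s, a, s') \<in> steps K} \<times> states K'"
    using closed by (auto simp: K'_def)
  moreover have "finite (states K')"
    using finite_imageI[OF fin(1), of g] by (simp add: K'_def e_def image_image)
  ultimately have "finite (steps K')"
    using fin(2) by (meson finite_SigmaI finite_subset)
  moreover have "kripke_structure K'"
  proof -
    have "label K' n \<subseteq> props K'" if "n \<in> states K'" for n
      using that lab' K F by (force simp: K'_def kripke_structure_def)
    moreover have "steps K' \<subseteq> states K' \<times> actions K' \<times> states K'" "inits K' \<subseteq> states K'"
      using K F closed by (auto simp: K'_def kripke_structure_def)
    ultimately show ?thesis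
      by (auto simp: kripke_structure_def)
  qed
  moreover have "bisimulation K' K ((\<lambda>s. (e s, s)) ` F)"
  proof -
    have "\<exists>t'. (t, a, t') \<in> steps K \<and> (n, t') \<in> (\<lambda>s. (e s, s)) ` F"
      if t: "t \<in> F" and n: "(e t, a, n) \<in> steps K'" for t a n
    proof -
      \<comment> \<open>The quotient step may come from another member \<open>s\<close> of the
        class; \<open>step\<close> transfers it to \<open>t\<close>.\<close>
      obtain s s' where s: "e t = e s" "n = e s'" "s \<in> F" "(s, a, s') \<in> steps K"
        using n by (auto simp: K'_def)
      then obtain t' where t': "(t, a, t') \<in> steps K" "h s' = h t'"
        using step t e_iff by metis
      moreover have "t' \<in> F"
        using closed t t'(1) by blast
      ultimately show ?thesis
        using s(2) by (auto simp: e_def)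
    qed
    moreover have "\<exists>n. (e s, a, n) \<in> steps K' \<and> (n, s') \<in> (\<lambda>s. (e s, s)) ` F"
      if "s \<in> F" "(s, a, s') \<in> steps K" for s a s'
    proof (intro exI conjI)
      show "(e s, a, e s') \<in> steps K'"
        using that by (auto simp: K'_def)
      show "(e s', s') \<in> (\<lambda>s. (e s, s)) ` F"
        using closed[OF that] by blast
    qed
    moreover have "(\<lambda>s. (e s, s)) ` F \<subseteq> states K' \<times> states K"
      using F(1) by (auto simp: K'_def)
    ultimately show ?thesis
      using lab' unfolding bisimulation_def by fast
  qed
  then have "bisimilar K' K"
    using F(2) by (fastforce simp: bisimilar_def K'_def)
  ultimately show ?thesis
    using \<open>finite (states K')\<close> by (auto simp: finite_kripke_def)
qed

section \<open>Executions as infinite paths of the unwinding\<close>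

lemma map_upt_two_Suc:
  "map x [0..<2 * Suc k + 1] = map x [0..<2 * k + 1] @ [x (Suc (2 * k)), x (2 * Suc k)]"
  by simp

lemma finite_executions_subset_words:
  assumes "kripke_structure K" and "intensional_strategy K lam"
  shows "finite_executions K lam \<subseteq> words K"
proof
  fix w
  assume "w \<in> finite_executions K lam"
  then show "w \<in> words K"
  proof induction
    case (start s)
    then show ?case
      using assms(1) by (auto simp: words_def letters_def kripke_structure_def)
  next
    case (extend w a s)
    then have "(a, s) \<in> actions K \<times> states K"
      using assms(2) unfolding intensional_strategy_def by blast
    then show ?case
      using extend by (auto simp: words_def letters_def)
  qed
qed

lemma finite_execution_prefix:
  assumes "w \<in> finite_executions K lam"
  shows "odd (length w) \<and> (\<forall>k. 2 * k + 1 \<le> length w \<longrightarrow> take (2 * k + 1) w \<in> finite_executions K lam)"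
  using assms
proof induction
  case (start s)
  then show ?case
    by (auto intro: finite_executions.start)
next
  case (extend w a s)
  have "take (2 * k + 1) (w @ [Inr a, Inl s]) \<in> finite_executions K lam"
    if "2 * k + 1 \<le> length (w @ [Inr a, Inl s])" for k
  proof (cases "2 * k + 1 \<le> length w")
    case True
    then show ?thesis
      using extend.IH by simp
  next
    case False
    then have "length w < 2 * k + 1" by simp
    moreover have "odd (length w)" using extend.IH by blast
    \<comment> \<open>Both lengths are odd and differ by at most two, so the prefix is the whole
      extended word.\<close>
    ultimately have "2 * k + 1 = length w + 2"
      using that by simp presburger
    then show ?thesis
      using extend.hyps by (simp add: finite_executions.extend)
  qed
  then show ?case
    using extend.IH by simp
qed

lemma finite_executions_snoc:
  assumes "w @ [x, y] \<in> finite_executions K lam" and "w \<noteq> []"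
  obtains a s where "x = Inr a" "y = Inl s" "w \<in> finite_executions K lam" "(a, s) \<in> choices lam w"
  using assms by (cases rule: finite_executions.cases) auto

lemma executionsE:
  assumes "x \<in> executions K lam"
  obtains s a where "s 0 \<in> inits K" "\<And>k. x (2 * k) = Inl (s k)" "\<And>k. x (Suc (2 * k)) = Inr (a k)"
    "\<And>k. (a k, s (Suc k)) \<in> choices lam (map x [0..<2 * k + 1])"
proof -
  obtain s a where "s 0 \<in> inits K" "\<forall>k. x (2 * k) = Inl (s k) \<and> x (2 * k + 1) = Inr (a (k + 1)) \<and>
      (a (k + 1), s (k + 1)) \<in> choices lam (map x [0..<2 * k + 1])"
    using assms unfolding executions_def by blast
  then show ?thesis
    using that[of s "\<lambda>k. a (k + 1)"] by (simp del: upt_Suc)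
qed

text \<open>Infinite executions are exactly the limits of finite ones. This links the pointwise
  definition to the inductive one, so later arguments can work with prefixes.\<close>

lemma in_executions_iff_prefixes:
  "x \<in> executions K lam \<longleftrightarrow> (\<forall>k. map x [0..<2 * k + 1] \<in> finite_executions K lam)"
proof
  assume "x \<in> executions K lam"
  then obtain s a where s: "s 0 \<in> inits K" "\<And>k. x (2 * k) = Inl (s k)"
    "\<And>k. x (Suc (2 * k)) = Inr (a k)"
    "\<And>k. (a k, s (Suc k)) \<in> choices lam (map x [0..<2 * k + 1])"
    by (rule executionsE) blast
  have "map x [0..<2 * k + 1] \<in> finite_executions K lam" for k
  proof (induction k)
    case 0
    then show ?case
      using s(1) s(2)[of 0] by (simp add: finite_executions.start)
  next
    case (Suc k)
    then show ?case
      unfolding map_upt_two_Suc s(2,3) using s(4) by (rule finite_executions.extend)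
  qed
  then show "\<forall>k. map x [0..<2 * k + 1] \<in> finite_executions K lam"
    by blast
next
  assume *: "\<forall>k. map x [0..<2 * k + 1] \<in> finite_executions K lam"
  have "\<exists>a s. x (Suc (2 * k)) = Inr a \<and> x (2 * Suc k) = Inl s \<and>
      (a, s) \<in> choices lam (map x [0..<2 * k + 1])" for k
    using *[rule_format, of "Suc k"] unfolding map_upt_two_Suc
    by (elim finite_executions_snoc) auto
  then obtain a s where as: "\<And>k. x (Suc (2 * k)) = Inr (a k)" "\<And>k. x (2 * Suc k) = Inl (s k)"
    "\<And>k. (a k, s k) \<in> choices lam (map x [0..<2 * k + 1])"
    by metis
  have "[x 0] \<in> finite_executions K lam"
    using *[rule_format, of 0] by simp
  then obtain s0 where s0: "s0 \<in> inits K" "x 0 = Inl s0"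
    by (cases rule: finite_executions.cases) auto
  \<comment> \<open>The chosen \<open>s k\<close> sits at position \<open>2 * Suc k\<close>, hence
    \<open>case_nat\<close> prepends the initial state. The witness \<open>a (k - 1)\<close> below
    matches the numbering of actions from one.\<close>
  have "x (2 * k) = Inl (case_nat s0 s k)" for k
    using s0 as(2) by (cases k) auto
  then show "x \<in> executions K lam"
    using s0 as(1,3) unfolding executions_def
    by (auto intro!: exI[of _ "case_nat s0 s"] exI[of _ "\<lambda>k. a (k - 1)"])
qed

text \<open>A state of the unwinding is a whole history, so an infinite path is the growing chain of
  prefixes of a single execution.\<close>

lemma traces_unwinding:
  assumes "kripke_structure K" and "intensional_strategy K lam"
  shows "traces (unwinding K lam) = label_word K ` executions K lam"
proof (intro subset_antisym subsetI)
  fix w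
  assume "w \<in> traces (unwinding K lam)"
  then obtain p b where w: "w = interleave (label (unwinding K lam) \<circ> p) b"
    and p: "path (unwinding K lam) p b"
    by (auto simp: traces_def)
  \<comment> \<open>Along a path every history ends in a state, so \<open>projl\<close> is applied
    to an \<open>Inl\<close> value.\<close>
  define s where "s k = projl (last (p k))" for k
  define x where "x = interleave s b"
  have "p k = map x [0..<2 * k + 1] \<and> p k \<in> finite_executions K lam" for k
  proof (induction k)
    case 0
    then show ?case
      using p by (auto simp: path_def unwinding_def x_def s_def interleave_def
          intro: finite_executions.start)
  next
    case (Suc k)
    have "(p k, b k, p (Suc k)) \<in> steps (unwinding K lam)"
      using p by (simp add: path_def)
    then obtain s' where s': "p (Suc k) = p k @ [Inr (b k), Inl s']" "(b k, s') \<in> choices lam (p k)"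
      by (auto simp: unwinding_def)
    then have "s (Suc k) = s'"
      by (simp add: s_def)
    then have "p (Suc k) = map x [0..<2 * Suc k + 1]"
      unfolding map_upt_two_Suc using s'(1) Suc.IH by (simp add: x_def del: mult_Suc_right)
    then show ?case
      using s' Suc.IH finite_executions.extend by metis
  qed
  then have p_eq: "p k = map x [0..<2 * k + 1]" and "p k \<in> finite_executions K lam" for k
    by blast+
  then have "x \<in> executions K lam"
    by (simp add: in_executions_iff_prefixes)
  moreover have "last (p k) = Inl (s k)" for k
    by (simp add: p_eq x_def)
  then have "w = label_word K x"
    by (simp add: w x_def label_word_def interleave_def unwinding_def fun_eq_iff)
  ultimately show "w \<in> label_word K ` executions K lam"
    by blast
next
  fix w
  assume "w \<in> label_word K ` executions K lam"
  then obtain x where w: "w = label_word K x" and x: "x \<in> executions K lam"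
    by blast
  from x obtain s a where s: "s 0 \<in> inits K" "\<And>k. x (2 * k) = Inl (s k)"
    "\<And>k. x (Suc (2 * k)) = Inr (a k)"
    "\<And>k. (a k, s (Suc k)) \<in> choices lam (map x [0..<2 * k + 1])"
    by (rule executionsE) blast
  define p where "p k = map x [0..<2 * k + 1]" for k
  have "p k \<in> words K" for k
    using x finite_executions_subset_words[OF assms] unfolding p_def in_executions_iff_prefixes
    by blast
  moreover have "p (Suc k) = p k @ [Inr (a k), Inl (s (Suc k))]" for k
    unfolding p_def map_upt_two_Suc s ..
  moreover have "p 0 = [Inl (s 0)]"
    using s(2)[of 0] by (simp add: p_def)
  ultimately have "path (unwinding K lam) p a"
    using s(1) s(4)[folded p_def] by (auto simp: path_def unwinding_def)
  moreover have "label (unwinding K lam) (p k) = label K (s k)" for k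
    using s(2) by (simp add: unwinding_def p_def)
  then have "w = interleave (label (unwinding K lam) \<circ> p) a"
    using s(2,3) by (intro eq_interleaveI) (auto simp: w label_word_def)
  ultimately show "w \<in> traces (unwinding K lam)"
    by (auto simp: traces_def)
qed

text \<open>Nontermination lets a choice be made again and again; the limit of the resulting words
  is an execution.\<close>

lemma finite_execution_extends:
  assumes "nonterminating K lam" and w: "w \<in> finite_executions K lam"
  obtains v where "w \<frown> v \<in> executions K lam"
proof -
  have "\<exists>u. \<forall>k. (u k \<in> finite_executions K lam \<and> (k = 0 \<longrightarrow> u k = w)) \<and>
      (\<exists>a s. u (Suc k) = u k @ [Inr a, Inl s])"
  proof (rule dependent_nat_choice)
    show "\<exists>u. u \<in> finite_executions K lam \<and> (0 = 0 \<longrightarrow> u = w)"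
      using w by blast
    fix u :: "('a + 'b) list" and k :: nat
    assume "u \<in> finite_executions K lam \<and> (k = 0 \<longrightarrow> u = w)"
    then show "\<exists>u'. (u' \<in> finite_executions K lam \<and> (Suc k = 0 \<longrightarrow> u' = w)) \<and>
        (\<exists>a s. u' = u @ [Inr a, Inl s])"
      using assms(1) finite_executions.extend unfolding nonterminating_def by fast
  qed
  then obtain u a s where u: "\<And>k. u k \<in> finite_executions K lam" "u 0 = w"
    "\<And>k. u (Suc k) = u k @ [Inr (a k), Inl (s k)]"
    by metis
  \<comment> \<open>Since \<open>w\<close> ends in a state, its continuation starts with an action:
    parities are swapped compared with \<open>interleave\<close>.\<close>
  define v where "v n = (if even n then Inr (a (n div 2)) else Inl (s (n div 2)))" for n
  have u_eq: "u k = w @ map v [0..<2 * k]" for k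
    by (induction k) (simp_all add: u(2,3) v_def)
  obtain m where m: "length w = 2 * m + 1"
    using finite_execution_prefix[OF w] by (auto elim: oddE)
  have "map (w \<frown> v) [0..<2 * k + 1] \<in> finite_executions K lam" for k
  proof (cases "k \<le> m")
    case True
    then have "map (w \<frown> v) [0..<2 * k + 1] = take (2 * k + 1) w"
      using m by (intro nth_equalityI) (auto simp: nth_append simp del: upt_Suc)
    then show ?thesis
      using True m finite_execution_prefix[OF w] by simp
  next
    case False
    then have "map (w \<frown> v) [0..<2 * k + 1] = u (k - m)"
      using m by (intro nth_equalityI) (auto simp: u_eq nth_append conc_def simp del: upt_Suc)
    then show ?thesis
      using u(1) by simp
  qed
  then show ?thesis
    using that in_executions_iff_prefixes by blast
qed

text \<open>Under nontermination every choice is witnessed by an infinite execution. Hence the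
  choices after \<open>w\<close> depend on \<open>w\<close> only through its residual, which makes
  merging by residuals sound.\<close>

lemma choices_eq_residual:
  assumes "nonterminating K lam" and w: "w \<in> finite_executions K lam"
  shows "choices lam w = {(a, s). \<exists>v \<in> residual (executions K lam) w. v 0 = Inr a \<and> v 1 = Inl s}"
proof -
  have "\<exists>v \<in> residual (executions K lam) w. v 0 = Inr a \<and> v 1 = Inl s"
    if as: "(a, s) \<in> choices lam w" for a s
  proof -
    obtain v where "(w @ [Inr a, Inl s]) \<frown> v \<in> executions K lam"
      using finite_execution_extends[OF assms(1) finite_executions.extend[OF w as]] .
    then have "[Inr a, Inl s] \<frown> v \<in> residual (executions K lam) w"
      by (simp add: residual_def)
    then show ?thesis
      by (rule bexI[rotated]) simp
  qed
  moreover have "(a, s) \<in> choices lam w"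
    if "v \<in> residual (executions K lam) w" "v 0 = Inr a" "v 1 = Inl s" for a s v
  proof -
    obtain m where m: "length w = 2 * m + 1"
      using finite_execution_prefix[OF w] by (auto elim: oddE)
    have "map (w \<frown> v) [0..<2 * m + 1] = w"
      using m by (intro nth_equalityI) (auto simp del: upt_Suc)
    moreover have "(w \<frown> v) (Suc (2 * m)) = Inr a" "(w \<frown> v) (2 * Suc m) = Inl s"
      using that(2,3) m by (simp_all add: conc_def)
    ultimately have "map (w \<frown> v) [0..<2 * Suc m + 1] = w @ [Inr a, Inl s]"
      unfolding map_upt_two_Suc by simp
    then have "w @ [Inr a, Inl s] \<in> finite_executions K lam"
      using that(1) in_executions_iff_prefixes[of "w \<frown> v"] unfolding residual_def
      by (metis mem_Collect_eq)
    moreover have "w \<noteq> []"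
      using m by auto
    ultimately show ?thesis
      by (rule finite_executions_snoc) simp
  qed
  ultimately show ?thesis
    by blast
qed

lemma omega_regular_imp_finite_bisimilar:
  fixes K :: "('s, 'a, 'p) kripke"
  assumes K: "kripke_structure K" and lam: "intensional_strategy K lam"
    and nt: "nonterminating K lam" and reg: "omega_regular (letters K) (executions K lam)"
  shows "\<exists>K' :: (nat, 'a, 'p) kripke. finite_kripke K' \<and> bisimilar K' (unwinding K lam)"
proof -
  let ?F = "finite_executions K lam" and ?E = "executions K lam" and ?U = "unwinding K lam"
  let ?L = "\<Union>x\<in>?E. range x"
  have finL: "finite ?L"
    using reg by (rule omega_regular_finite_letters)
  have letter: "l \<in> ?L" if w: "w \<in> ?F" "l \<in> set w" for w l
  proof -
    obtain v where "w \<frown> v \<in> ?E"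
      using finite_execution_extends[OF nt w(1)] .
    moreover have "l \<in> range (w \<frown> v)"
      using w(2) by simp
    ultimately show ?thesis
      by blast
  qed
  have stepE: "\<exists>s. w' = w @ [Inr a, Inl s] \<and> (a, s) \<in> choices lam w"
    if "(w, a, w') \<in> steps ?U" for w a w'
    using that by (auto simp: unwinding_def)
  have stepI: "(w, a, w @ [Inr a, Inl s]) \<in> steps ?U" if "w \<in> ?F" "(a, s) \<in> choices lam w" for w a s
    using that finite_executions_subset_words[OF K lam] by (auto simp: unwinding_def)
  show ?thesis
  \<comment> \<open>The residual fixes the future but not the label of the present state, so the
    last letter is kept as well.\<close>
  proof (rule finite_quotient_bisimilar[where F = ?F and h = "\<lambda>w. (residual ?E w, last w)"])
    show "kripke_structure ?U"
      using K lam by (rule kripke_structure_unwinding)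
    show "?F \<subseteq> states ?U"
      using finite_executions_subset_words[OF K lam] by (simp add: unwinding_def)
    show "inits ?U \<subseteq> ?F"
      by (auto simp: unwinding_def intro: finite_executions.start)
    show closed: "w' \<in> ?F" if "w \<in> ?F" "(w, a, w') \<in> steps ?U" for w a w'
      using that stepE finite_executions.extend by metis
    have "(\<lambda>w. (residual ?E w, last w)) ` ?F \<subseteq> range (residual ?E) \<times> ?L"
      using letter finite_executions_subset_words[OF K lam]
      by (auto simp: words_def subset_iff simp del: UN_iff)
    then show "finite ((\<lambda>w. (residual ?E w, last w)) ` ?F)"
      using omega_regular_finite_residuals[OF reg] finL by (meson finite_SigmaI finite_subset)
    have "Inr a \<in> ?L" if "w \<in> ?F" "(w, a, w') \<in> steps ?U" for w a w'
    proof -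
      have "Inr a \<in> set w'"
        using stepE[OF that(2)] by auto
      then show ?thesis
        using letter closed[OF that] by blast
    qed
    then have "{a. \<exists>w\<in>?F. \<exists>w'. (w, a, w') \<in> steps ?U} \<subseteq> Inr -` ?L"
      by (intro subsetI) (elim CollectE bexE exE, simp only: vimage_eq)
    then show "finite {a. \<exists>w\<in>?F. \<exists>w'. (w, a, w') \<in> steps ?U}"
      using finite_vimageI[OF finL inj_Inr] finite_subset by blast
    show "label ?U w = label ?U u" if "(residual ?E w, last w) = (residual ?E u, last u)" for w u
      using that by (simp add: unwinding_def)
    show "\<exists>u'. (u, a, u') \<in> steps ?U \<and> (residual ?E w', last w') = (residual ?E u', last u')"
      if w: "w \<in> ?F" and u: "u \<in> ?F" and eq: "(residual ?E w, last w) = (residual ?E u, last u)"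
        and st: "(w, a, w') \<in> steps ?U" for w u a w'
    proof -
      obtain s where s: "w' = w @ [Inr a, Inl s]" "(a, s) \<in> choices lam w"
        using stepE[OF st] by blast
      have "choices lam w = choices lam u"
        using eq unfolding choices_eq_residual[OF nt w] choices_eq_residual[OF nt u] by simp
      then have "(u, a, u @ [Inr a, Inl s]) \<in> steps ?U"
        using stepI[OF u] s(2) by simp
      \<comment> \<open>Appending the same two letters to words with equal residuals keeps the
        residuals equal.\<close>
      moreover have "residual ?E w' = residual ?E (u @ [Inr a, Inl s])"
        using eq by (simp only: s(1) residual_append prod.inject)
      ultimately show ?thesis
        using s(1) by auto
    qed
  qed
qed

section \<open>A strategy with a finite bisimilar structure and no regular set of executions\<close>

definition pow2_indicator :: "nat \<Rightarrow> nat" where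
  "pow2_indicator k = (if \<exists>m. k = 2 ^ m then 1 else 0)"

lemma pow2_indicator_not_periodic:
  assumes "d > 0"
  shows "\<exists>k\<ge>n. pow2_indicator (k + d) \<noteq> pow2_indicator k"
proof -
  \<comment> \<open>With this \<open>m\<close>, \<open>0 < d < 2 ^ m\<close>, so
    \<open>2 ^ m + d\<close> lies strictly between consecutive powers of two.\<close>
  define m where "m = n + d"
  have m: "m < 2 ^ m"
    by (rule less_exp)
  have "2 ^ m + d \<noteq> 2 ^ j" for j :: nat
  proof
    assume eq: "2 ^ m + d = 2 ^ j"
    then have "(2::nat) ^ m < 2 ^ j" "(2::nat) ^ j < 2 ^ Suc m"
      using assms m unfolding m_def power_Suc by linarith+
    then have "m < j" "j < Suc m"
      by (simp_all only: power_strict_increasing_iff[of "2::nat"] one_less_numeral_iff semiring_norm)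
    then show False by simp
  qed
  then have "pow2_indicator (2 ^ m + d) \<noteq> pow2_indicator (2 ^ m)"
    by (auto simp: pow2_indicator_def)
  moreover have "n \<le> 2 ^ m"
    using m unfolding m_def by linarith
  ultimately show ?thesis
    by blast
qed

definition pow2_kripke :: "(nat, nat, nat) kripke" where
  "pow2_kripke = \<lparr> states = {0, 1}, actions = {0}, steps = {0, 1} \<times> {0} \<times> {0, 1},
     inits = {0}, props = {}, label = (\<lambda>_. {}) \<rparr>"

text \<open>A word ending in the \<open>k\<close>-th state has length \<open>2 * k + 1\<close>.\<close>

definition pow2_strategy :: "(nat, nat) strategy" where
  "pow2_strategy w =
     (if w \<in> words pow2_kripke then Some {(0, pow2_indicator (Suc (length w div 2)))} else None)"

lemma choices_pow2_strategy:
  "choices pow2_strategy w =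
     (if w \<in> words pow2_kripke then {(0, pow2_indicator (Suc (length w div 2)))} else {})"
  by (simp add: choices_def pow2_strategy_def)

lemma pow2_indicator_in: "pow2_indicator k \<in> {0, 1}"
  by (simp add: pow2_indicator_def)

lemma kripke_structure_pow2: "kripke_structure pow2_kripke"
  by (auto simp: kripke_structure_def pow2_kripke_def)

lemma intensional_strategy_pow2: "intensional_strategy pow2_kripke pow2_strategy"
proof -
  have "dom pow2_strategy \<subseteq> words pow2_kripke"
    by (auto simp: pow2_strategy_def dom_def split: if_splits)
  moreover have "choices pow2_strategy w \<subseteq> actions pow2_kripke \<times> states pow2_kripke" for w
    using pow2_indicator_in by (auto simp: choices_pow2_strategy pow2_kripke_def)
  moreover have "(s, a, s') \<in> steps pow2_kripke"
    if "(a, s') \<in> choices pow2_strategy (w @ [Inl s])" for w s a s'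
    using that pow2_indicator_in[of "Suc (length (w @ [Inl s]) div 2)"]
    by (auto simp: choices_pow2_strategy words_def letters_def pow2_kripke_def split: if_splits)
  ultimately show ?thesis
    by (simp add: intensional_strategy_def)
qed

lemma nonterminating_pow2: "nonterminating pow2_kripke pow2_strategy"
  using finite_executions_subset_words[OF kripke_structure_pow2 intensional_strategy_pow2]
  by (auto simp: nonterminating_def choices_pow2_strategy)

lemma pow2_executions:
  "executions pow2_kripke pow2_strategy = {interleave pow2_indicator (\<lambda>_. 0)}"
proof -
  have "x = interleave pow2_indicator (\<lambda>_. 0)" if "x \<in> executions pow2_kripke pow2_strategy" for x
  proof -
    obtain s a where s: "s 0 \<in> inits pow2_kripke" "\<And>k. x (2 * k) = Inl (s k)"
      "\<And>k. x (Suc (2 * k)) = Inr (a k)"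
      "\<And>k. (a k, s (Suc k)) \<in> choices pow2_strategy (map x [0..<2 * k + 1])"
      using \<open>x \<in> _\<close> by (rule executionsE) blast
    have as: "a k = 0 \<and> s (Suc k) = pow2_indicator (Suc k)" for k
      using s(4)[of k] by (auto simp: choices_pow2_strategy split: if_splits)
    \<comment> \<open>Zero is not a power of two, so the indicator agrees with the initial
      state.\<close>
    have "s 0 = pow2_indicator 0"
      using s(1) by (simp add: pow2_kripke_def pow2_indicator_def)
    then have "s k = pow2_indicator k" for k
      using as by (cases k) auto
    then show ?thesis
      using s(2,3) as by (intro eq_interleaveI) auto
  qed
  \<comment> \<open>So far there is at most one execution; nontermination supplies one.\<close>
  moreover have "executions pow2_kripke pow2_strategy \<noteq> {}"
  proof -
    have "[Inl 0] \<in> finite_executions pow2_kripke pow2_strategy"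
      by (rule finite_executions.start) (simp add: pow2_kripke_def)
    then show ?thesis
      using finite_execution_extends[OF nonterminating_pow2] by blast
  qed
  ultimately show ?thesis
    by blast
qed

text \<open>Pumping down must return the only execution itself, which would make it ultimately
  periodic.\<close>

lemma pow2_not_omega_regular:
  "\<not> omega_regular \<Sigma> (executions pow2_kripke pow2_strategy)"
proof
  let ?x = "interleave pow2_indicator (\<lambda>_. 0) :: nat \<Rightarrow> nat + nat"
  assume "omega_regular \<Sigma> (executions pow2_kripke pow2_strategy)"
  then obtain i d where d: "d > 0" and eq: "(\<lambda>n. if n < i then ?x n else ?x (n + d)) = ?x"
    using omega_regular_pump[of \<Sigma> "executions pow2_kripke pow2_strategy" ?x]
    unfolding pow2_executions by blast
  have periodic: "?x (n + d) = ?x n" if "n \<ge> i" for n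
    using fun_cong[OF eq, of n] that by simp
  show False
  \<comment> \<open>An even period is a period of the indicator after halving; an odd one would put
    an action where a state belongs.\<close>
  proof (cases "even d")
    case True
    then obtain d' where d': "d = 2 * d'" by blast
    have "pow2_indicator (k + d') = pow2_indicator k" if "k \<ge> i" for k
      using periodic[of "2 * k"] that by (simp add: d' interleave_def)
    then show False
      using pow2_indicator_not_periodic[of d' i] d d' by auto
  next
    case False
    then show False
      using periodic[of "2 * i"] by (simp add: interleave_def)
  qed
qed

text \<open>Every word, even one that is no execution, has exactly one successor, reached by action
  \<open>0\<close>, and an empty label. A constant \<open>h\<close> therefore merges all words into
  one looping state.\<close>

lemma pow2_finite_bisimilar:
  "\<exists>K' :: (nat, nat, nat) kripke. finite_kripke K' \<and> bisimilar K' (unwinding pow2_kripke pow2_strategy)"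
proof -
  let ?U = "unwinding pow2_kripke pow2_strategy"
  have U: "kripke_structure ?U"
    using kripke_structure_pow2 intensional_strategy_pow2 by (rule kripke_structure_unwinding)
  have acts: "{a. \<exists>w\<in>words pow2_kripke. \<exists>w'. (w, a, w') \<in> steps ?U} \<subseteq> {0}"
    by (auto simp: unwinding_def choices_pow2_strategy split: if_splits)
  show ?thesis
  proof (rule finite_quotient_bisimilar[where F = "words pow2_kripke" and h = "\<lambda>_. ()"])
    show "finite {a. \<exists>w\<in>words pow2_kripke. \<exists>w'. (w, a, w') \<in> steps ?U}"
      using acts finite_subset by blast
    show "w' \<in> words pow2_kripke" if "(w, a, w') \<in> steps ?U" for w a w'
      using that U by (auto simp: kripke_structure_def unwinding_def)
    show "inits ?U \<subseteq> words pow2_kripke"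
      using U by (auto simp: kripke_structure_def unwinding_def)
    show "kripke_structure ?U"
      by (rule U)
    show "label ?U w = label ?U u" for w u
      by (auto simp: unwinding_def pow2_kripke_def split: sum.split)
  qed (auto simp: unwinding_def choices_pow2_strategy)
qed

section \<open>The three claims combined\<close>

theorem theorem1:
  fixes K :: "('s, 'a, 'p) kripke" and lam :: "('s, 'a) strategy"
  assumes "kripke_structure K" and "intensional_strategy K lam"
  shows
    "(nonterminating K lam \<and> omega_regular (letters K) (executions K lam) \<longrightarrow>
        (\<exists>K' :: (nat, 'a, 'p) kripke. finite_kripke K' \<and> bisimilar K' (unwinding K lam)))
     \<and>
     (\<exists>(K0 :: (nat, nat, nat) kripke) (lam0 :: (nat, nat) strategy).
        kripke_structure K0 \<and> finite (states K0) \<and> finite (actions K0) \<and> finite (props K0) \<and>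
        intensional_strategy K0 lam0 \<and> nonterminating K0 lam0 \<and>
        (\<exists>K' :: (nat, nat, nat) kripke. finite_kripke K' \<and> bisimilar K' (unwinding K0 lam0)) \<and>
        \<not> omega_regular (letters K0) (executions K0 lam0))
     \<and>
     ((\<exists>K' :: ('t, 'a, 'p) kripke. finite_kripke K' \<and> bisimilar K' (unwinding K lam)) \<longrightarrow>
        omega_regular (label_letters K) (label_word K ` executions K lam))"
proof (intro conjI impI)
  assume "nonterminating K lam \<and> omega_regular (letters K) (executions K lam)"
  then show "\<exists>K' :: (nat, 'a, 'p) kripke. finite_kripke K' \<and> bisimilar K' (unwinding K lam)"
    using omega_regular_imp_finite_bisimilar assms by blast
next
  have "finite (states pow2_kripke)" "finite (actions pow2_kripke)" "finite (props pow2_kripke)"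
    by (simp_all add: pow2_kripke_def)
  then show "\<exists>(K0 :: (nat, nat, nat) kripke) (lam0 :: (nat, nat) strategy).
        kripke_structure K0 \<and> finite (states K0) \<and> finite (actions K0) \<and> finite (props K0) \<and>
        intensional_strategy K0 lam0 \<and> nonterminating K0 lam0 \<and>
        (\<exists>K' :: (nat, nat, nat) kripke. finite_kripke K' \<and> bisimilar K' (unwinding K0 lam0)) \<and>
        \<not> omega_regular (letters K0) (executions K0 lam0)"
    using kripke_structure_pow2 intensional_strategy_pow2 nonterminating_pow2
      pow2_finite_bisimilar pow2_not_omega_regular by blast
next
  assume "\<exists>K' :: ('t, 'a, 'p) kripke. finite_kripke K' \<and> bisimilar K' (unwinding K lam)"
  then obtain K' :: "('t, 'a, 'p) kripke"
    where K': "finite_kripke K'" "bisimilar K' (unwinding K lam)"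
    by blast
  have "label_letters K' = label_letters K"
    using K'(2) by (simp add: label_letters_def bisimilar_def unwinding_def)
  moreover have "traces K' = label_word K ` executions K lam"
    using traces_eq_if_bisimilar[OF K'(2)] traces_unwinding[OF assms] by simp
  ultimately show "omega_regular (label_letters K) (label_word K ` executions K lam)"
    using omega_regular_traces[OF K'(1)] by simp
qed

end
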